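(* The following hold. (i) For any games $G, H_1, H_2, \widehat{H} \in \widetilde{\mathbb{G}}$, if $\mathcal{G}(H_1) = \mathcal{G}(H_2)$, then $\mathcal{G}(G :_{\widehat{H}} H_1) = \mathcal{G}(G :_{\widehat{H}} H_2)$. (ii) For any games $G, H, \widehat{H}_1, \widehat{H}_2 \in \widetilde{\mathbb{G}}$, if $\mathcal{G}(\widehat{H}_1) = \mathcal{G}(\widehat{H}_2)$, then $\mathcal{G}(G :_{\widehat{H}_1} H) = \mathcal{G}(G :_{\widehat{H}_2} H)$.
   Context: Impartial games: set $\widetilde{\mathbb{G}}_0 = \{\emptyset\}$ and $\widetilde{\mathbb{G}}_n = 2^{\widetilde{\mathbb{G}}_{n-1}}$ (power set) for $n \geq 1$, and $\widetilde{\mathbb{G}} = \bigcup_{n \in \mathbb{Z}_{\geq 0}} \widetilde{\mathbb{G}}_n$. Elements of $\widetilde{\mathbb{G}}$ are called games; the elements of a game $G$ are its options. Ordinal sum with substitution: for $G, H, \widehat{H} \in \widetilde{\mathbb{G}}$, the game $G :_{\widehat{H}} H$ is defined recursively by $$G :_{\widehat{H}} H = \{ G' :_{\widehat{H}} \widehat{H} \mid G' \in G\} \cup \{ G :_{\widehat{H}} H' \mid H' \in H \}.$$ The Grundy number of a game is defined recursively by $\mathcal{G}(G) = \operatorname{mex}\{\mathcal{G}(G') \mid G' \in G\}$, where $\operatorname{mex} A = \min(\mathbb{Z}_{\geq 0} \setminus A)$ for $A \subsetneq \mathbb{Z}_{\geq 0}$. *)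

theory Defs
  imports "HOL-Library.FSet"
begin

text \<open>
  The games are the hereditarily finite sets. Two games with the same options are equal, and
  every finite set of games is a game.
\<close>

datatype game = Game (opts: "game fset")

text \<open>
  The cumulative hierarchy of the usual definition. Each level is finite, so all of its subsets
  are finite and the successor level is the full power set; the levels exhaust the type.
\<close>

primrec game_level :: "nat \<Rightarrow> game set" where
  "game_level 0 = {Game {||}}"
| "game_level (Suc n) = {G. fset (opts G) \<subseteq> game_level n}"

lemma finite_game_level: "finite (game_level n)"
proof (induction n)
  case 0
  show ?case by simp
next
  case (Suc n)
  have "inj_on (\<lambda>G. fset (opts G)) (game_level (Suc n))"
    by (auto simp: inj_on_def fset_inject game.expand)
  moreover have "(\<lambda>G. fset (opts G)) ` game_level (Suc n) \<subseteq> Pow (game_level n)"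
    by auto
  ultimately show ?case
    using Suc by (meson finite_Pow_iff finite_subset inj_on_finite)
qed

lemma game_level_Suc_eq_Pow: "(\<lambda>G. fset (opts G)) ` game_level (Suc n) = Pow (game_level n)"
proof (intro equalityI subsetI)
  fix A assume "A \<in> Pow (game_level n)"
  moreover from this have "finite A"
    using finite_game_level finite_subset by blast
  ultimately have "A = fset (opts (Game (Abs_fset A)))" "Game (Abs_fset A) \<in> game_level (Suc n)"
    by (auto simp: Abs_fset_inverse)
  then show "A \<in> (\<lambda>G. fset (opts G)) ` game_level (Suc n)"
    by blast
qed auto

lemma game_level_subset_Suc: "game_level n \<subseteq> game_level (Suc n)"
  by (induction n) auto

lemma game_level_mono: "m \<le> n \<Longrightarrow> game_level m \<subseteq> game_level n"
  using lift_Suc_mono_le[of game_level m n] game_level_subset_Suc by blast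

lemma Union_game_level: "(\<Union>n. game_level n) = UNIV"
proof -
  have "\<exists>n. G \<in> game_level n" for G
  proof (induction G)
    case (Game X)
    then obtain f where f: "\<And>G. G \<in> fset X \<Longrightarrow> G \<in> game_level (f G)"
      by metis
    have "G \<in> game_level (Max (f ` fset X))" if "G \<in> fset X" for G
      using that f[OF that] game_level_mono[of "f G" "Max (f ` fset X)"] by auto
    then have "Game X \<in> game_level (Suc (Max (f ` fset X)))"
      by auto
    then show ?case by blast
  qed
  then show ?thesis by auto
qed

lemma size_opts: "G' |\<in>| opts G \<Longrightarrow> size G' < size G"
  by (cases G) (auto simp: less_Suc_eq_le intro!: order.trans[OF _ member_le_sum])

text \<open>\<open>osum G K H\<close> is the ordinal sum of \<open>G\<close> and \<open>H\<close> with substitution \<open>K\<close>.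
  After a move in \<open>G\<close> the second summand is reset to \<open>K\<close>; the substitution itself never changes.\<close>

function osum :: "game \<Rightarrow> game \<Rightarrow> game \<Rightarrow> game" where
  "osum G K H = Game ((\<lambda>G'. osum G' K K) |`| opts G |\<union>| (\<lambda>H'. osum G K H') |`| opts H)"
  by pat_completeness auto
termination
  by (relation "measures [\<lambda>(G, K, H). size G, \<lambda>(G, K, H). size H]") (auto dest: size_opts)

declare osum.simps [simp del]

text \<open>Only meaningful for proper subsets of the naturals; \<open>grundy\<close> applies it to finite sets only.\<close>

definition mex :: "nat set \<Rightarrow> nat" where
  "mex A = (LEAST n. n \<notin> A)"

function grundy :: "game \<Rightarrow> nat" where
  "grundy G = mex (grundy ` fset (opts G))"
  by pat_completeness auto
termination
  by (relation "measure size") (auto dest: size_opts)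

declare grundy.simps [simp del]

end

theory Submission
  imports Defs "HOL-Library.Infinite_Set"
begin

text \<open>
  For a finite set \<open>A\<close> of naturals, let \<open>e\<close> enumerate the complement of \<open>A\<close> in increasing order.
  Then \<open>mex (A \<union> e ` S) = e (mex S)\<close>. With \<open>A\<close> the set of Grundy numbers of the positions reached
  by a move in \<open>G\<close>, induction on \<open>H\<close> turns this into \<open>\<G>(G :\<^sub>K H) = e (\<G>(H))\<close>, which is (i).
  For (ii), induction on \<open>G\<close> together with (i) shows that \<open>A\<close> depends on \<open>K\<close> only through \<open>\<G>(K)\<close>.
\<close>

lemma mex_eqI: "n \<notin> A \<Longrightarrow> {..<n} \<subseteq> A \<Longrightarrow> mex A = n"
  unfolding mex_def by (rule Least_equality) (auto intro: leI)

lemma mex_notin: "finite A \<Longrightarrow> mex A \<notin> A"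
  unfolding mex_def by (rule LeastI_ex) (simp add: ex_new_if_finite)

lemma less_mexD: "n < mex A \<Longrightarrow> n \<in> A"
  unfolding mex_def using not_less_Least by blast

text \<open>As \<open>enumerate (- A)\<close> is strictly increasing, a number below its value at
  \<open>mex S\<close> lies in \<open>A\<close> or is its value at some \<open>i < mex S\<close>, so
  that \<open>i\<close> is in \<open>S\<close>.\<close>

lemma mex_Un_enumerate_compl:
  assumes "finite A" "finite S"
  shows "mex (A \<union> enumerate (- A) ` S) = enumerate (- A) (mex S)"
proof -
  have inf: "infinite (- A)"
    using assms(1) by (simp add: finite_compl)
  note mono = strict_mono_enumerate[OF inf]
  show ?thesis
  proof (rule mex_eqI)
    show "enumerate (- A) (mex S) \<notin> A \<union> enumerate (- A) ` S"
      using enumerate_in_set[OF inf, of "mex S"] mex_notin[OF assms(2)]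
      by (auto simp: strict_mono_eq[OF mono])
    show "{..<enumerate (- A) (mex S)} \<subseteq> A \<union> enumerate (- A) ` S"
    proof
      fix x assume x: "x \<in> {..<enumerate (- A) (mex S)}"
      show "x \<in> A \<union> enumerate (- A) ` S"
      proof (cases "x \<in> A")
        case False
        then obtain i where i: "enumerate (- A) i = x"
          using enumerate_Ex[of "- A" x] inf by auto
        with x have "i \<in> S"
          by (auto simp: strict_mono_less[OF mono] intro: less_mexD)
        with i show ?thesis by blast
      qed simp
    qed
  qed
qed

text \<open>A move in \<open>G\<close> resets the second summand to \<open>K\<close>, so the set
  left out of the enumeration stays fixed while \<open>H\<close> varies.\<close>

lemma grundy_osum:
  "grundy (osum G K H) =
    enumerate (- (\<lambda>G'. grundy (osum G' K K)) ` fset (opts G)) (grundy H)"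
proof (induction H)
  case (Game X)
  let ?A = "(\<lambda>G'. grundy (osum G' K K)) ` fset (opts G)"
  have "grundy (osum G K (Game X)) = mex (?A \<union> (\<lambda>H'. grundy (osum G K H')) ` fset X)"
    by (subst osum.simps, subst grundy.simps) (simp add: image_Un image_image)
  also have "(\<lambda>H'. grundy (osum G K H')) ` fset X = enumerate (- ?A) ` grundy ` fset X"
    by (simp add: image_image Game cong: image_cong)
  also have "mex (?A \<union> \<dots>) = enumerate (- ?A) (grundy (Game X))"
    by (simp add: mex_Un_enumerate_compl grundy.simps[of "Game X"])
  finally show ?case .
qed

lemma grundy_osum_cong_right:
  "grundy H1 = grundy H2 \<Longrightarrow> grundy (osum G K H1) = grundy (osum G K H2)"
  by (simp only: grundy_osum[of G K H1] grundy_osum[of G K H2])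

lemma grundy_osum_cong_subst:
  assumes "grundy K1 = grundy K2"
  shows "grundy (osum G K1 H) = grundy (osum G K2 H)"
proof (induction G arbitrary: H)
  case (Game X)
  \<comment> \<open>Here \<open>K1\<close> is both substitution and second summand: the induction
    hypothesis changes the former, part (i) the latter.\<close>
  have "grundy (osum G' K1 K1) = grundy (osum G' K2 K2)" if "G' \<in> fset X" for G'
    using Game[OF that] grundy_osum_cong_right[OF assms] by simp
  then show ?case
    by (simp add: grundy_osum[of "Game X"] cong: image_cong)
qed

theorem corollary3p9:
  "(\<forall>G H1 H2 K :: game. grundy H1 = grundy H2 \<longrightarrow> grundy (osum G K H1) = grundy (osum G K H2)) \<and>
   (\<forall>G H K1 K2 :: game. grundy K1 = grundy K2 \<longrightarrow> grundy (osum G K1 H) = grundy (osum G K2 H))"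
  using grundy_osum_cong_right grundy_osum_cong_subst by blast

end
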